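(* Let $\mathfrak{X},\mathfrak{Y},\mathfrak{Z}$ be linear spaces over $\mathbb{K}$ and let $A\subseteq\mathfrak{X}\times\mathfrak{Z}$ and $B\subseteq\mathfrak{X}\times\mathfrak{Y}$ be two linear relations. Call a quadruple of families $(\{z_\alpha\}_{\alpha\in I},\{y_\alpha\}_{\alpha\in I},\{x'_\beta\}_{\beta\in J},\{y'_\beta\}_{\beta\in J})$ admissible if $\{z_\alpha\}_{\alpha\in I}$ is a Hamel basis for $\mathrm{ran}\,A$, $\{y_\alpha\}_{\alpha\in I}$ is a linearly independent family with $y_\alpha\in BA^{-1}(z_\alpha)$ for all $\alpha\in I$, $\{x'_\beta\}_{\beta\in J}$ is a Hamel basis for $\ker A$, $\{y'_\beta\}_{\beta\in J}$ is a family with $y'_\beta\in B(x'_\beta)$ for all $\beta\in J$, and $\mathrm{Sp}\{y_\alpha\}_{\alpha\in I}\cap\mathrm{Sp}\{y'_\beta\}_{\beta\in J}=\{0\}$. (1) For every admissible quadruple, let $C$ be the operator between $\mathfrak{Y}$ and $\mathfrak{Z}$ with domain $\mathrm{Sp}\{y_\alpha\}_{\alpha\in I}\oplus\mathrm{Sp}\{y'_\beta\}_{\beta\in J}$ defined by $$C\Bigl(\sum_{\alpha\in I_0}\lambda_\alpha y_\alpha+\sum_{\beta\in J_0}\lambda'_\beta y'_\beta\Bigr)=\sum_{\alpha\in I_0}\lambda_\alpha z_\alpha\qquad( * )$$ for all finite $I_0\subseteq I$, $J_0\subseteq J$ and scalars $\lambda_\alpha,\lambda'_\beta\in\mathbb{K}$.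 Then $C$ and all of its extensions (to operators) are solutions $X$ of the problem $A\subseteq XB$. Moreover, $\mathrm{dom}\,C=\mathrm{Sp}\{y_\alpha\}_{\alpha\in I}\oplus\mathrm{Sp}\{y'_\beta\}_{\beta\in J}$, $\mathrm{ran}\,C=\mathrm{ran}\,A$ and $\ker C=\mathrm{Sp}\{y'_\beta\}_{\beta\in J}$. (2) Conversely, if $C$ is an operator between $\mathfrak{Y}$ and $\mathfrak{Z}$ which satisfies $A\subseteq CB$, then there exists an admissible quadruple such that $\mathrm{dom}\,C\supseteq\mathrm{Sp}\{y_\alpha\}_{\alpha\in I}\oplus\mathrm{Sp}\{y'_\beta\}_{\beta\in J}$ and the restriction of $C$ to $\mathrm{Sp}\{y_\alpha\}_{\alpha\in I}\oplus\mathrm{Sp}\{y'_\beta\}_{\beta\in J}$ has the form $( * )$.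
   Context: $\mathbb{K}$ is $\mathbb{R}$ or $\mathbb{C}$. A linear relation between linear spaces $\mathfrak{X}$ and $\mathfrak{Y}$ is a linear subspace $R$ of $\mathfrak{X}\times\mathfrak{Y}$. Its inverse is $R^{-1}=\{(y,x):(x,y)\in R\}$. For $x\in\mathfrak{X}$, $R(x)=\{y:(x,y)\in R\}$. Put $\mathrm{dom}\,R=\{x:(x,y)\in R\text{ for some }y\}$, $\mathrm{ran}\,R=\{y:(x,y)\in R\text{ for some }x\}$, $\ker R=\{x:(x,0)\in R\}$, $\mathrm{mul}\,R=R(0)$. For linear relations $R\subseteq\mathfrak{X}\times\mathfrak{Y}$ and $S\subseteq\mathfrak{Y}\times\mathfrak{Z}$ the product is $SR=\{(x,z):(x,y)\in R\text{ and }(y,z)\in S\text{ for some }y\in\mathfrak{Y}\}$. An operator between $\mathfrak{X}$ and $\mathfrak{Y}$ is a linear map defined on a linear subspace of $\mathfrak{X}$ (not necessarily all of $\mathfrak{X}$) with values in $\mathfrak{Y}$; it is identified with its graph, i.e. with a linear relation $R$ with $\mathrm{mul}\,R=\{0\}$. $\mathrm{Sp}$ denotes linear span and $\oplus$ a direct sum of subspaces. By convention, $\{0\}$ is considered as the only linearly independent system (Hamel basis) of the null space.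
   Formalization: If ran A = {0}, the family {y_α} is required to be the single vector 0 (a nonzero y would make ker C = Sp{y'_β} false); if ran A ≠ {0}, {y_α} must be genuinely linearly independent, so the system {0} is not allowed. *)

theory Defs
  imports "HOL-Analysis.Product_Vector"
begin

text \<open>
  The scalar field is the field of real or of complex numbers, up to isomorphism of fields;
  linear spaces over it are given by the locale \<^locale>\<open>vector_space\<close>.
\<close>

class real_or_complex = field +
  assumes real_or_complex:
    "(\<exists>f :: 'a \<Rightarrow> real. bij f \<and> (\<forall>a b. f (a + b) = f a + f b) \<and> (\<forall>a b. f (a * b) = f a * f b)) \<or>
     (\<exists>f :: 'a \<Rightarrow> complex. bij f \<and> (\<forall>a b. f (a + b) = f a + f b) \<and> (\<forall>a b. f (a * b) = f a * f b))"

instance real :: real_or_complex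
  by standard (rule disjI1, rule exI[of _ "\<lambda>x. x"], simp add: bij_def)

instance complex :: real_or_complex
  by standard (rule disjI2, rule exI[of _ "\<lambda>x. x"], simp add: bij_def)

text \<open>
  For a relation \<open>R\<close>, the domain, range, inverse and \<open>R(x)\<close> are \<open>Domain R\<close>, \<open>Range R\<close>, \<open>R\<inverse>\<close>
  and \<open>R `` {x}\<close>. The product \<open>SR\<close> (first \<open>R\<close>, then \<open>S\<close>) is \<open>R O S\<close>: the order is reversed.
\<close>

definition linear_relation ::
    "('k :: field \<Rightarrow> 'x \<Rightarrow> 'x) \<Rightarrow> ('k \<Rightarrow> 'y \<Rightarrow> 'y) \<Rightarrow>
     ('x :: ab_group_add \<times> 'y :: ab_group_add) set \<Rightarrow> bool"
  where "linear_relation sx sy R \<longleftrightarrow> module.subspace (module_prod.scale sx sy) R"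

definition ker_rel :: "('x \<times> 'y :: zero) set \<Rightarrow> 'x set"
  where "ker_rel R = {x. (x, 0) \<in> R}"

definition mul_rel :: "('x :: zero \<times> 'y) set \<Rightarrow> 'y set"
  where "mul_rel R = R `` {0}"

definition operator_rel ::
    "('k :: field \<Rightarrow> 'x \<Rightarrow> 'x) \<Rightarrow> ('k \<Rightarrow> 'y \<Rightarrow> 'y) \<Rightarrow>
     ('x :: ab_group_add \<times> 'y :: ab_group_add) set \<Rightarrow> bool"
  where "operator_rel sx sy R \<longleftrightarrow> linear_relation sx sy R \<and> mul_rel R = {0}"

text \<open>Directness, \<open>U \<inter> V = {0}\<close>, is not part of this definition; it is part of \<open>admissible\<close> below.\<close>

definition subspace_sum :: "'v :: ab_group_add set \<Rightarrow> 'v set \<Rightarrow> 'v set"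
  where "subspace_sum U V = {u + v | u v. u \<in> U \<and> v \<in> V}"

definition independent_family ::
    "('k :: field \<Rightarrow> 'v \<Rightarrow> 'v) \<Rightarrow> 'i set \<Rightarrow> ('i \<Rightarrow> 'v :: ab_group_add) \<Rightarrow> bool"
  where "independent_family s I v \<longleftrightarrow> inj_on v I \<and> \<not> module.dependent s (v ` I)"

text \<open>
  By convention the null space has exactly one linearly independent system (Hamel basis),
  namely \<open>{0}\<close>: the family with a single member, equal to \<open>0\<close>.
\<close>

definition null_system :: "'i set \<Rightarrow> ('i \<Rightarrow> 'v :: zero) \<Rightarrow> bool"
  where "null_system I v \<longleftrightarrow> (\<exists>i. I = {i} \<and> v i = 0)"

definition hamel_basis ::
    "('k :: field \<Rightarrow> 'v \<Rightarrow> 'v) \<Rightarrow> 'v set \<Rightarrow> 'i set \<Rightarrow> ('i \<Rightarrow> 'v :: ab_group_add) \<Rightarrow> bool"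
  where "hamel_basis s V I v \<longleftrightarrow>
    (if V = {0} then null_system I v
     else independent_family s I v \<and> module.span s (v ` I) = V)"

text \<open>
  If \<open>ran A = {0}\<close>, the convention applies to \<open>y\<close> together with \<open>z\<close>: both are the system
  \<open>{0}\<close>. A nonzero single \<open>y\<close> paired with \<open>z = 0\<close> would belong to the kernel of the operator
  \<open>C\<close> below without belonging to \<open>Sp y'\<close>. If \<open>ran A \<noteq> {0}\<close>, the system \<open>{0}\<close> is not an
  independent choice for \<open>y\<close>, since \<open>C\<close> would have to map \<open>0\<close> to a nonzero vector.
  If \<open>ker A = {0}\<close>, then \<open>x'\<close> is \<open>{0}\<close>, and the single member of \<open>y'\<close> is any element of \<open>B(0)\<close>.
\<close>

definition admissible ::
    "('k :: field \<Rightarrow> 'x \<Rightarrow> 'x) \<Rightarrow> ('k \<Rightarrow> 'y \<Rightarrow> 'y) \<Rightarrow> ('k \<Rightarrow> 'z \<Rightarrow> 'z) \<Rightarrow>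
     ('x :: ab_group_add \<times> 'z :: ab_group_add) set \<Rightarrow> ('x \<times> 'y :: ab_group_add) set \<Rightarrow>
     'i set \<Rightarrow> ('i \<Rightarrow> 'z) \<Rightarrow> ('i \<Rightarrow> 'y) \<Rightarrow> 'j set \<Rightarrow> ('j \<Rightarrow> 'x) \<Rightarrow> ('j \<Rightarrow> 'y) \<Rightarrow> bool"
  where "admissible sx sy sz A B I z y J x' y' \<longleftrightarrow>
    hamel_basis sz (Range A) I z \<and>
    (if Range A = {0} then null_system I y else independent_family sy I y) \<and>
    (\<forall>\<alpha>\<in>I. y \<alpha> \<in> (A\<inverse> O B) `` {z \<alpha>}) \<and>
    hamel_basis sx (ker_rel A) J x' \<and>
    (\<forall>\<beta>\<in>J. y' \<beta> \<in> B `` {x' \<beta>}) \<and>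
    module.span sy (y ` I) \<inter> module.span sy (y' ` J) = {0}"

text \<open>
  The graph of the assignment
  \<open>(\<Sum>\<alpha>\<in>I0. \<lambda>\<^sub>\<alpha> y\<^sub>\<alpha>) + (\<Sum>\<beta>\<in>J0. \<lambda>'\<^sub>\<beta> y'\<^sub>\<beta>) \<mapsto> (\<Sum>\<alpha>\<in>I0. \<lambda>\<^sub>\<alpha> z\<^sub>\<alpha>)\<close>, for finite \<open>I0 \<subseteq> I\<close> and \<open>J0 \<subseteq> J\<close>.
  That it is single-valued and linear is a claim, not part of the definition.
\<close>

definition assigned_rel ::
    "('k :: field \<Rightarrow> 'y \<Rightarrow> 'y) \<Rightarrow> ('k \<Rightarrow> 'z \<Rightarrow> 'z) \<Rightarrow>
     'i set \<Rightarrow> ('i \<Rightarrow> 'z :: ab_group_add) \<Rightarrow> ('i \<Rightarrow> 'y :: ab_group_add) \<Rightarrow>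
     'j set \<Rightarrow> ('j \<Rightarrow> 'y) \<Rightarrow> ('y \<times> 'z) set"
  where "assigned_rel sy sz I z y J y' =
    {((\<Sum>\<alpha>\<in>I0. sy (l \<alpha>) (y \<alpha>)) + (\<Sum>\<beta>\<in>J0. sy (l' \<beta>) (y' \<beta>)), \<Sum>\<alpha>\<in>I0. sz (l \<alpha>) (z \<alpha>))
      | I0 J0 l l'. finite I0 \<and> I0 \<subseteq> I \<and> finite J0 \<and> J0 \<subseteq> J}"

end

theory Submission
  imports Defs
begin

text \<open>
  The relation \<open>(*)\<close> is the span, in the product space, of the pairs \<open>(y\<^sub>\<alpha>, z\<^sub>\<alpha>)\<close> and
  \<open>(y'\<^sub>\<beta>, 0)\<close>. If \<open>(x, z) \<in> A\<close> and \<open>z = \<Sum> \<lambda>\<^sub>\<alpha> z\<^sub>\<alpha>\<close>, then choosing \<open>x\<^sub>\<alpha>\<close> with \<open>(x\<^sub>\<alpha>, z\<^sub>\<alpha>) \<in> A\<close>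
  and \<open>(x\<^sub>\<alpha>, y\<^sub>\<alpha>) \<in> B\<close> leaves a remainder \<open>x - \<Sum> \<lambda>\<^sub>\<alpha> x\<^sub>\<alpha>\<close> in \<open>ker A\<close>, which is expanded in the
  \<open>x'\<^sub>\<beta>\<close>. Conversely, given a solution \<open>C\<close>, one picks the \<open>y\<^sub>\<alpha>\<close> and \<open>y'\<^sub>\<beta>\<close> as intermediate
  points of the factorisation of \<open>(x\<^sub>\<alpha>, z\<^sub>\<alpha>)\<close> and \<open>(x'\<^sub>\<beta>, 0)\<close> through \<open>B\<close> and \<open>C\<close>; as \<open>C\<close> is
  single-valued, a linear dependence among the \<open>y\<^sub>\<alpha>\<close> modulo \<open>Sp y'\<close> would give one
  among the \<open>z\<^sub>\<alpha>\<close>.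
\<close>

section \<open>Spans, independence and Hamel bases of indexed families\<close>

lemma (in module) sum_in_span_family:
  "F \<subseteq> I \<Longrightarrow> (\<Sum>i\<in>F. l i *s f i) \<in> span (f ` I)"
  by (intro span_sum span_scale span_base) auto

lemma (in module) span_family:
  "span (f ` I) = {\<Sum>i\<in>F. l i *s f i | F l. finite F \<and> F \<subseteq> I}"
proof (intro set_eqI iffI)
  fix x assume "x \<in> span (f ` I)"
  then obtain t r where t: "finite t" "t \<subseteq> f ` I" and x: "x = (\<Sum>a\<in>t. r a *s a)"
    by (auto simp: span_explicit)
  from t obtain F where F: "F \<subseteq> I" "inj_on f F" "t = f ` F"
    by (auto simp: subset_image_inj)
  then have "finite F" "x = (\<Sum>i\<in>F. r (f i) *s f i)"
    using t x by (auto simp: finite_image_iff sum.reindex)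
  with F show "x \<in> {\<Sum>i\<in>F. l i *s f i | F l. finite F \<and> F \<subseteq> I}"
    by (intro CollectI exI[of _ F] exI[of _ "\<lambda>i. r (f i)"]) simp
qed (auto intro: sum_in_span_family)

text \<open>Coefficients are attached to indices here, so that a linear relation can be carried from
  one family to another over the same index set.\<close>

lemma (in vector_space) independent_family_iff:
  "independent_family scale I v \<longleftrightarrow>
    (\<forall>F l. finite F \<longrightarrow> F \<subseteq> I \<longrightarrow> (\<Sum>i\<in>F. l i *s v i) = 0 \<longrightarrow> (\<forall>i\<in>F. l i = 0))"
  (is "?L \<longleftrightarrow> ?R")
proof
  assume ?L
  then have inj: "inj_on v I" and ind: "independent (v ` I)"
    by (auto simp: independent_family_def)
  show ?R
  proof (intro allI impI ballI)
    fix F l i assume F: "finite F" "F \<subseteq> I" and 0: "(\<Sum>i\<in>F. l i *s v i) = 0" and i: "i \<in> F"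
    have injF: "inj_on v F" using inj F by (rule_tac inj_on_subset)
    \<comment> \<open>Independence of a set uses coefficients indexed by vectors; by injectivity,
      \<open>inv_into F v\<close> translates between the two.\<close>
    have "(\<Sum>w\<in>v ` F. l (inv_into F v w) *s w) = 0"
      using 0 injF by (simp add: sum.reindex)
    from independentD[OF ind _ _ this, of "v i"] F i show "l i = 0"
      using injF by (auto simp: image_mono)
  qed
next
  assume R: ?R
  have inj: "inj_on v I"
  proof (rule inj_onI, rule ccontr)
    fix i j assume "i \<in> I" "j \<in> I" "v i = v j" "i \<noteq> j"
    \<comment> \<open>With coefficients 1 and -1, two equal members at distinct indices would
      satisfy a nontrivial relation.\<close>
    with R[rule_format, of "{i, j}" "\<lambda>k. if k = i then 1 else - 1" i] show False
      by simp
  qed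
  moreover have "independent (v ` I)"
    unfolding independent_explicit_module
  proof (intro allI impI)
    fix t u w assume t: "finite t" "t \<subseteq> v ` I" "(\<Sum>w\<in>t. u w *s w) = 0" "w \<in> t"
    then obtain F where F: "F \<subseteq> I" "inj_on v F" "t = v ` F"
      by (auto simp: subset_image_inj)
    moreover from this t have "finite F" "(\<Sum>i\<in>F. u (v i) *s v i) = 0"
      by (simp_all add: finite_image_iff sum.reindex)
    ultimately show "u w = 0"
      using R[rule_format, of F "\<lambda>i. u (v i)"] t(4) by blast
  qed
  ultimately show ?L
    by (simp add: independent_family_def)
qed

text \<open>Each basis vector serves as its own index, which fixes the index types of the converse.
  For the null space, the index set \<open>{0}\<close> realises the convention.\<close>

lemma (in vector_space) hamel_basis_exists:
  assumes "subspace V"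
  obtains I where "I \<subseteq> V" "hamel_basis scale V I (\<lambda>v. v)"
proof (cases "V = {0}")
  case True
  then show ?thesis
    by (intro that[of "{0}"]) (auto simp: hamel_basis_def null_system_def)
next
  case False
  obtain I where "I \<subseteq> V" "independent I" "V \<subseteq> span I"
    by (rule maximal_independent_subset)
  with False assms show ?thesis
    by (intro that[of I])
       (auto simp: hamel_basis_def independent_family_def dest: span_minimal)
qed

lemma (in vector_space) span_hamel_basis:
  "hamel_basis scale V I v \<Longrightarrow> span (v ` I) = V"
  by (auto simp: hamel_basis_def null_system_def split: if_splits)

text \<open>The null space is excluded because its conventional basis admits every
  coefficient.\<close>

lemma (in vector_space) hamel_basis_sum_eq_0:
  assumes "hamel_basis scale V I v" "V \<noteq> {0}" "finite F" "F \<subseteq> I"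
    and "(\<Sum>i\<in>F. l i *s v i) = 0" "i \<in> F"
  shows "l i = 0"
  using assms by (auto simp: hamel_basis_def independent_family_iff)

section \<open>Linear relations and single-valuedness\<close>

lemma linear_relation_iff:
  assumes "vector_space sx" "vector_space sy"
  shows "linear_relation sx sy R \<longleftrightarrow>
    (0, 0) \<in> R \<and>
    (\<forall>x y x' y'. (x, y) \<in> R \<longrightarrow> (x', y') \<in> R \<longrightarrow> (x + x', y + y') \<in> R) \<and>
    (\<forall>c x y. (x, y) \<in> R \<longrightarrow> (sx c x, sy c y) \<in> R)"
proof -
  interpret vector_space_prod sx sy
    using assms by (simp add: vector_space_prod_def vector_space_pair_def)
  show ?thesis
    unfolding linear_relation_def p.subspace_def Ball_def split_paired_All
    by (auto simp: zero_prod_def scale_prod)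
qed

lemma linear_relation_sum:
  assumes "vector_space sx" "vector_space sy" "linear_relation sx sy R"
    and "\<And>i. i \<in> F \<Longrightarrow> (u i, v i) \<in> R"
  shows "((\<Sum>i\<in>F. sx (l i) (u i)), (\<Sum>i\<in>F. sy (l i) (v i))) \<in> R"
  using assms(4)
  \<comment> \<open>For infinite \<open>F\<close> both sums are 0 by default, and
    \<open>(0, 0) \<in> R\<close>.\<close>
  by (induction F rule: infinite_finite_induct)
     (use assms(3) in \<open>auto simp: linear_relation_iff[OF assms(1,2)]\<close>)

lemma linear_relation_diff:
  assumes "vector_space sx" "vector_space sy" "linear_relation sx sy R"
    and "(x, y) \<in> R" "(x', y') \<in> R"
  shows "(x - x', y - y') \<in> R"
proof -
  interpret X: vector_space sx by fact
  interpret Y: vector_space sy by fact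
  have "(x + sx (- 1) x', y + sy (- 1) y') \<in> R"
    using assms(3-5) unfolding linear_relation_iff[OF assms(1,2)] by blast
  then show ?thesis by simp
qed

lemma subspace_Range:
  assumes "vector_space sx" "vector_space sy" "linear_relation sx sy R"
  shows "module.subspace sy (Range R)"
proof -
  interpret Y: vector_space sy by fact
  show ?thesis
    using assms(3) unfolding linear_relation_iff[OF assms(1,2)] Y.subspace_def
    by (auto simp: Range_iff) blast+
qed

lemma subspace_ker_rel:
  assumes "vector_space sx" "vector_space sy" "linear_relation sx sy R"
  shows "module.subspace sx (ker_rel R)"
proof -
  interpret X: vector_space sx by fact
  interpret Y: vector_space sy by fact
  show ?thesis
    using assms(3) unfolding linear_relation_iff[OF assms(1,2)] X.subspace_def ker_rel_def
    by (metis (no_types, lifting) Y.scale_zero_right add_0 mem_Collect_eq)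
qed

text \<open>Subtracting the two pairs puts \<open>y - y'\<close> into the multivalued part of
  \<open>R\<close>.\<close>

lemma operator_relD:
  assumes "vector_space sx" "vector_space sy" "operator_rel sx sy R"
    and "(x, y) \<in> R" "(x, y') \<in> R"
  shows "y = y'"
proof -
  have "(x - x, y - y') \<in> R"
    using assms by (intro linear_relation_diff) (auto simp: operator_rel_def)
  then have "y - y' \<in> mul_rel R"
    by (simp add: mul_rel_def)
  with assms(3) show ?thesis
    by (simp add: operator_rel_def)
qed

lemma assigned_relI:
  assumes "finite F" "F \<subseteq> I" "finite G" "G \<subseteq> J"
    and "v = (\<Sum>\<alpha>\<in>F. sy (l \<alpha>) (y \<alpha>)) + (\<Sum>\<beta>\<in>G. sy (m \<beta>) (y' \<beta>))"
    and "w = (\<Sum>\<alpha>\<in>F. sz (l \<alpha>) (z \<alpha>))"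
  shows "(v, w) \<in> assigned_rel sy sz I z y J y'"
  using assms unfolding assigned_rel_def by blast

lemma assigned_relE:
  assumes "(v, w) \<in> assigned_rel sy sz I z y J y'"
  obtains F G l m where "finite F" "F \<subseteq> I" "finite G" "G \<subseteq> J"
    and "v = (\<Sum>\<alpha>\<in>F. sy (l \<alpha>) (y \<alpha>)) + (\<Sum>\<beta>\<in>G. sy (m \<beta>) (y' \<beta>))"
    and "w = (\<Sum>\<alpha>\<in>F. sz (l \<alpha>) (z \<alpha>))"
  using assms unfolding assigned_rel_def by blast

lemma assigned_rel_eq_span:
  assumes "vector_space sy" "vector_space sz"
  shows "assigned_rel sy sz I z y J y' =
    module.span (module_prod.scale sy sz) ((\<lambda>\<alpha>. (y \<alpha>, z \<alpha>)) ` I \<union> (\<lambda>\<beta>. (y' \<beta>, 0)) ` J)"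
proof -
  interpret vector_space_prod sy sz
    using assms by (simp add: vector_space_prod_def vector_space_pair_def)
  interpret Z: vector_space sz by fact
  have I: "p.span ((\<lambda>\<alpha>. (y \<alpha>, z \<alpha>)) ` I) =
      {(\<Sum>\<alpha>\<in>F. sy (l \<alpha>) (y \<alpha>), \<Sum>\<alpha>\<in>F. sz (l \<alpha>) (z \<alpha>)) | F l. finite F \<and> F \<subseteq> I}"
    by (simp add: p.span_family scale_prod sum_prod)
  have J: "p.span ((\<lambda>\<beta>. (y' \<beta>, 0)) ` J) =
      {(\<Sum>\<beta>\<in>G. sy (m \<beta>) (y' \<beta>), 0) | G m. finite G \<and> G \<subseteq> J}"
    by (simp add: p.span_family scale_prod sum_prod)
  show ?thesis
    unfolding p.span_Un I J
  proof (intro equalityI subrelI)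
    fix v w assume "(v, w) \<in> assigned_rel sy sz I z y J y'"
    then obtain F G l m where "finite F" "F \<subseteq> I" "finite G" "G \<subseteq> J"
      and "(v, w) = (\<Sum>\<alpha>\<in>F. sy (l \<alpha>) (y \<alpha>), \<Sum>\<alpha>\<in>F. sz (l \<alpha>) (z \<alpha>)) +
        (\<Sum>\<beta>\<in>G. sy (m \<beta>) (y' \<beta>), 0)"
      by (elim assigned_relE) (simp add: that)
    then show "(v, w) \<in> {a + b | a b.
        a \<in> {(\<Sum>\<alpha>\<in>F. sy (l \<alpha>) (y \<alpha>), \<Sum>\<alpha>\<in>F. sz (l \<alpha>) (z \<alpha>)) | F l. finite F \<and> F \<subseteq> I} \<and>
        b \<in> {(\<Sum>\<beta>\<in>G. sy (m \<beta>) (y' \<beta>), 0) | G m. finite G \<and> G \<subseteq> J}}"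
      by blast
  next
    fix v w assume "(v, w) \<in> {a + b | a b.
        a \<in> {(\<Sum>\<alpha>\<in>F. sy (l \<alpha>) (y \<alpha>), \<Sum>\<alpha>\<in>F. sz (l \<alpha>) (z \<alpha>)) | F l. finite F \<and> F \<subseteq> I} \<and>
        b \<in> {(\<Sum>\<beta>\<in>G. sy (m \<beta>) (y' \<beta>), 0) | G m. finite G \<and> G \<subseteq> J}}"
    then obtain F l G m where "finite F" "F \<subseteq> I" "finite G" "G \<subseteq> J"
      and "(v, w) = (\<Sum>\<alpha>\<in>F. sy (l \<alpha>) (y \<alpha>), \<Sum>\<alpha>\<in>F. sz (l \<alpha>) (z \<alpha>)) +
        (\<Sum>\<beta>\<in>G. sy (m \<beta>) (y' \<beta>), 0)"
      by blast
    then show "(v, w) \<in> assigned_rel sy sz I z y J y'"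
      by (intro assigned_relI[of F I G J]) simp_all
  qed
qed

lemma linear_relation_assigned_rel:
  assumes "vector_space sy" "vector_space sz"
  shows "linear_relation sy sz (assigned_rel sy sz I z y J y')"
proof -
  interpret vector_space_prod sy sz
    using assms by (simp add: vector_space_prod_def vector_space_pair_def)
  show ?thesis
    by (simp add: linear_relation_def assigned_rel_eq_span[OF assms])
qed

lemma assigned_rel_subset:
  assumes "vector_space sy" "vector_space sz" "linear_relation sy sz C"
    and "\<And>\<alpha>. \<alpha> \<in> I \<Longrightarrow> (y \<alpha>, z \<alpha>) \<in> C" "\<And>\<beta>. \<beta> \<in> J \<Longrightarrow> (y' \<beta>, 0) \<in> C"
  shows "assigned_rel sy sz I z y J y' \<subseteq> C"
proof -
  interpret vector_space_prod sy sz
    using assms by (simp add: vector_space_prod_def vector_space_pair_def)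
  show ?thesis
    unfolding assigned_rel_eq_span[OF assms(1,2)]
    using assms(3-5) by (intro p.span_minimal) (auto simp: linear_relation_def)
qed

lemma Domain_assigned_rel:
  assumes "vector_space sy"
  shows "Domain (assigned_rel sy sz I z y J y') =
    subspace_sum (module.span sy (y ` I)) (module.span sy (y' ` J))"
proof -
  interpret Y: vector_space sy by fact
  show ?thesis
    by (auto simp: subspace_sum_def Y.span_family Domain_iff elim!: assigned_relE
        intro: assigned_relI)
qed

lemma Range_assigned_rel:
  assumes "vector_space sz"
  shows "Range (assigned_rel sy sz I z y J y') = module.span sz (z ` I)"
proof -
  interpret Z: vector_space sz by fact
  show ?thesis
    by (auto simp: Z.span_family Range_iff elim!: assigned_relE
        intro: assigned_relI[where G = "{}"])
qed

section \<open>The operator given by an admissible quadruple\<close>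

locale admissible_quadruple =
  X: vector_space sx + Y: vector_space sy + Z: vector_space sz
  for sx :: "'k :: field \<Rightarrow> 'x :: ab_group_add \<Rightarrow> 'x"
    and sy :: "'k \<Rightarrow> 'y :: ab_group_add \<Rightarrow> 'y"
    and sz :: "'k \<Rightarrow> 'z :: ab_group_add \<Rightarrow> 'z" +
  fixes A :: "('x \<times> 'z) set" and B :: "('x \<times> 'y) set"
    and I :: "'i set" and z :: "'i \<Rightarrow> 'z" and y :: "'i \<Rightarrow> 'y"
    and J :: "'j set" and x' :: "'j \<Rightarrow> 'x" and y' :: "'j \<Rightarrow> 'y"
  assumes A: "linear_relation sx sz A" and B: "linear_relation sx sy B"
    and adm: "admissible sx sy sz A B I z y J x' y'"
begin

abbreviation C :: "('y \<times> 'z) set"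
  where "C \<equiv> assigned_rel sy sz I z y J y'"

lemma basis_z: "hamel_basis sz (Range A) I z"
  and family_y: "if Range A = {0} then null_system I y else independent_family sy I y"
  and basis_x': "hamel_basis sx (ker_rel A) J x'"
  and direct: "Y.span (y ` I) \<inter> Y.span (y' ` J) = {0}"
  using adm unfolding admissible_def by blast+

lemma y: "\<alpha> \<in> I \<Longrightarrow> \<exists>x. (x, z \<alpha>) \<in> A \<and> (x, y \<alpha>) \<in> B"
  and y': "\<beta> \<in> J \<Longrightarrow> (x' \<beta>, y' \<beta>) \<in> B"
  using adm unfolding admissible_def by blast+

text \<open>Either all members of both families are 0, or both families are independent and each sum
  vanishes only with all its coefficients. From left to right this gives single-valuedness of
  \<open>C\<close>, from right to left its kernel.\<close>

lemma sum_y_eq_0_iff: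
  assumes "finite F" "F \<subseteq> I"
  shows "(\<Sum>\<alpha>\<in>F. sy (l \<alpha>) (y \<alpha>)) = 0 \<longleftrightarrow> (\<Sum>\<alpha>\<in>F. sz (l \<alpha>) (z \<alpha>)) = 0"
proof (cases "Range A = {0}")
  case True
  then have "\<forall>\<alpha>\<in>F. y \<alpha> = 0 \<and> z \<alpha> = 0"
    using basis_z family_y assms(2) by (auto simp: hamel_basis_def null_system_def)
  then show ?thesis by simp
next
  case False
  then have "independent_family sy I y" "independent_family sz I z"
    using basis_z family_y by (simp_all add: hamel_basis_def)
  then have "l \<alpha> = 0"
    if "\<alpha> \<in> F" "(\<Sum>\<alpha>\<in>F. sy (l \<alpha>) (y \<alpha>)) = 0 \<or> (\<Sum>\<alpha>\<in>F. sz (l \<alpha>) (z \<alpha>)) = 0" for \<alpha>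
    using that assms Y.independent_family_iff[THEN iffD1, rule_format, of I y F l \<alpha>]
      Z.independent_family_iff[THEN iffD1, rule_format, of I z F l \<alpha>] by satx
  then show ?thesis
    by (metis (mono_tags, lifting) Y.scale_zero_left Z.scale_zero_left sum.neutral)
qed

text \<open>When the argument is 0, its \<open>y\<close>-part is the negative of its
  \<open>y'\<close>-part. It therefore lies in both spans and vanishes by directness, and the value
  vanishes with it.\<close>

lemma operator_rel_C: "operator_rel sy sz C"
proof -
  have "w = 0" if "(0, w) \<in> C" for w
  proof -
    from that obtain F G l m where F: "finite F" "F \<subseteq> I" and G: "finite G" "G \<subseteq> J"
      and 0: "(\<Sum>\<alpha>\<in>F. sy (l \<alpha>) (y \<alpha>)) + (\<Sum>\<beta>\<in>G. sy (m \<beta>) (y' \<beta>)) = 0"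
      and w: "w = (\<Sum>\<alpha>\<in>F. sz (l \<alpha>) (z \<alpha>))"
      by (elim assigned_relE) (simp add: that)
    let ?u = "\<Sum>\<alpha>\<in>F. sy (l \<alpha>) (y \<alpha>)"
    have "?u = - (\<Sum>\<beta>\<in>G. sy (m \<beta>) (y' \<beta>))"
      using 0 by (simp only: eq_neg_iff_add_eq_0)
    also have "\<dots> \<in> Y.span (y' ` J)"
      using G by (intro Y.span_neg Y.sum_in_span_family)
    finally have "?u \<in> Y.span (y ` I) \<inter> Y.span (y' ` J)"
      using Y.sum_in_span_family[OF F(2)] by (intro IntI)
    then have "?u = 0"
      by (simp only: direct singleton_iff)
    with F show ?thesis
      unfolding w by (simp only: sum_y_eq_0_iff)
  qed
  moreover have lin: "linear_relation sy sz C"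
    by (rule linear_relation_assigned_rel; unfold_locales)
  moreover from lin have "(0, 0) \<in> C"
    by (simp only: linear_relation_iff[OF Y.vector_space_axioms Z.vector_space_axioms])
  ultimately show ?thesis
    unfolding operator_rel_def mul_rel_def by blast
qed

lemma subset_comp_C: "A \<subseteq> B O C"
proof (rule subrelI)
  fix x w assume xw: "(x, w) \<in> A"
  then have "w \<in> Z.span (z ` I)"
    unfolding Z.span_hamel_basis[OF basis_z] by blast
  then obtain F l where F: "finite F" "F \<subseteq> I" and w: "w = (\<Sum>\<alpha>\<in>F. sz (l \<alpha>) (z \<alpha>))"
    by (auto simp: Z.span_family)
  from y obtain u where u: "(u \<alpha>, z \<alpha>) \<in> A" "(u \<alpha>, y \<alpha>) \<in> B" if "\<alpha> \<in> I" for \<alpha>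
    by metis
  let ?u = "\<Sum>\<alpha>\<in>F. sx (l \<alpha>) (u \<alpha>)"
  have "(?u, w) \<in> A" unfolding w
    using F u(1) A by (intro linear_relation_sum) (unfold_locales, auto)
  with xw have "(x - ?u, w - w) \<in> A"
    using A by (intro linear_relation_diff) (unfold_locales, auto)
  then have "x - ?u \<in> X.span (x' ` J)"
    unfolding X.span_hamel_basis[OF basis_x'] ker_rel_def by simp
  then obtain G m where G: "finite G" "G \<subseteq> J" and eq: "x - ?u = (\<Sum>\<beta>\<in>G. sx (m \<beta>) (x' \<beta>))"
    by (auto simp: X.span_family)
  have 1: "(?u, \<Sum>\<alpha>\<in>F. sy (l \<alpha>) (y \<alpha>)) \<in> B"
    using F u(2) B by (intro linear_relation_sum) (unfold_locales, auto)
  have 2: "(x - ?u, \<Sum>\<beta>\<in>G. sy (m \<beta>) (y' \<beta>)) \<in> B" unfolding eq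
    using G y' B by (intro linear_relation_sum) (unfold_locales, auto)
  let ?v = "(\<Sum>\<alpha>\<in>F. sy (l \<alpha>) (y \<alpha>)) + (\<Sum>\<beta>\<in>G. sy (m \<beta>) (y' \<beta>))"
  have "(?u + (x - ?u), ?v) \<in> B"
    using B 1 2
    unfolding linear_relation_iff[OF X.vector_space_axioms Y.vector_space_axioms] by blast
  then have "(x, ?v) \<in> B" by simp
  moreover have "(?v, w) \<in> C"
    using F G w by (intro assigned_relI) auto
  ultimately show "(x, w) \<in> B O C" by blast
qed

text \<open>A vanishing value forces the \<open>y\<close>-part to vanish by
  \<open>sum_y_eq_0_iff\<close>; conversely, an empty \<open>y\<close>-part has value 0.\<close>

lemma ker_rel_C: "ker_rel C = Y.span (y' ` J)"
proof
  show "ker_rel C \<subseteq> Y.span (y' ` J)"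
  proof
    fix v assume "v \<in> ker_rel C"
    then have "(v, 0) \<in> C" by (simp add: ker_rel_def)
    then obtain F G l m where F: "finite F" "F \<subseteq> I" and G: "G \<subseteq> J"
      and v: "v = (\<Sum>\<alpha>\<in>F. sy (l \<alpha>) (y \<alpha>)) + (\<Sum>\<beta>\<in>G. sy (m \<beta>) (y' \<beta>))"
      and 0: "(\<Sum>\<alpha>\<in>F. sz (l \<alpha>) (z \<alpha>)) = 0"
      by (auto elim!: assigned_relE)
    from 0 have "(\<Sum>\<alpha>\<in>F. sy (l \<alpha>) (y \<alpha>)) = 0"
      using F by (simp add: sum_y_eq_0_iff)
    with v G show "v \<in> Y.span (y' ` J)"
      by (simp add: Y.sum_in_span_family)
  qed
  show "Y.span (y' ` J) \<subseteq> ker_rel C"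
    by (auto simp: ker_rel_def Y.span_family intro: assigned_relI[where F = "{}"])
qed

end

section \<open>An admissible quadruple from a given solution\<close>

lemma admissible_from_solution:
  fixes sx :: "'k :: field \<Rightarrow> 'x :: ab_group_add \<Rightarrow> 'x"
    and sy :: "'k \<Rightarrow> 'y :: ab_group_add \<Rightarrow> 'y"
    and sz :: "'k \<Rightarrow> 'z :: ab_group_add \<Rightarrow> 'z"
  assumes vs: "vector_space sx" "vector_space sy" "vector_space sz"
    and A: "linear_relation sx sz A" and B: "linear_relation sx sy B"
    and C: "operator_rel sy sz C" and sol: "A \<subseteq> B O C"
  shows "\<exists>(I :: 'z set) z y (J :: 'x set) x' y'.
    admissible sx sy sz A B I z y J x' y' \<and>
    (\<forall>\<alpha>\<in>I. (y \<alpha>, z \<alpha>) \<in> C) \<and> (\<forall>\<beta>\<in>J. (y' \<beta>, 0) \<in> C)"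
proof -
  interpret X: vector_space sx by fact
  interpret Y: vector_space sy by fact
  interpret Z: vector_space sz by fact
  have lC: "linear_relation sy sz C"
    using C by (simp add: operator_rel_def)
  have zero: "(0, 0) \<in> A" "(0, 0) \<in> B" "(0, 0) \<in> C"
    using A B lC vs by (simp_all add: linear_relation_iff)
  obtain I where I: "I \<subseteq> Range A" "hamel_basis sz (Range A) I (\<lambda>z. z)"
    using Z.hamel_basis_exists[OF subspace_Range[OF vs(1,3) A]] .
  obtain J where J: "J \<subseteq> ker_rel A" "hamel_basis sx (ker_rel A) J (\<lambda>x. x)"
    using X.hamel_basis_exists[OF subspace_ker_rel[OF vs(1,3) A]] .
  \<comment> \<open>If \<open>Range A = {0}\<close>, an intermediate point could be a nonzero
    element of the kernel of \<open>C\<close>, whereas the convention asks for \<open>y = 0\<close>.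
    The choice \<open>x = u = 0\<close> is then available, since
    \<open>\<alpha> = 0\<close>.\<close>
  have "\<exists>u. (\<exists>x. (x, \<alpha>) \<in> A \<and> (x, u) \<in> B) \<and> (u, \<alpha>) \<in> C \<and> (Range A = {0} \<longrightarrow> u = 0)"
    if "\<alpha> \<in> I" for \<alpha>
  proof (cases "Range A = {0}")
    case True
    with that I(1) zero show ?thesis by auto
  next
    case False
    from that I(1) obtain x where "(x, \<alpha>) \<in> A" by blast
    with sol obtain u where "(x, u) \<in> B" "(u, \<alpha>) \<in> C" by blast
    with \<open>(x, \<alpha>) \<in> A\<close> False show ?thesis by blast
  qed
  then obtain y where y: "\<exists>x. (x, \<alpha>) \<in> A \<and> (x, y \<alpha>) \<in> B" "(y \<alpha>, \<alpha>) \<in> C"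
    "Range A = {0} \<longrightarrow> y \<alpha> = 0" if "\<alpha> \<in> I" for \<alpha>
    by metis
  have "\<exists>u. (\<beta>, u) \<in> B \<and> (u, 0) \<in> C" if "\<beta> \<in> J" for \<beta>
    using that J(1) sol by (auto simp: ker_rel_def)
  then obtain y' where y': "(\<beta>, y' \<beta>) \<in> B" "(y' \<beta>, 0) \<in> C" if "\<beta> \<in> J" for \<beta>
    by metis
  have C_sum: "((\<Sum>\<alpha>\<in>F. sy (l \<alpha>) (y \<alpha>)), (\<Sum>\<alpha>\<in>F. sz (l \<alpha>) \<alpha>)) \<in> C" if "F \<subseteq> I" for F l
    using that y(2) vs lC by (intro linear_relation_sum) auto
  have indep_y: "independent_family sy I y" if ne: "Range A \<noteq> {0}"
    unfolding Y.independent_family_iff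
  proof (intro allI impI)
    fix F l assume F: "finite F" "F \<subseteq> I" "(\<Sum>\<alpha>\<in>F. sy (l \<alpha>) (y \<alpha>)) = 0"
    \<comment> \<open>The sum on the left is an image of 0 under \<open>C\<close>, as is 0 itself by
      \<open>(0, 0) \<in> C\<close>.\<close>
    with C_sum[of F l] have "(\<Sum>\<alpha>\<in>F. sz (l \<alpha>) \<alpha>) = 0"
      by (simp add: operator_relD[OF vs(2,3) C _ zero(3)])
    from Z.hamel_basis_sum_eq_0[OF I(2) ne F(1,2) this] show "\<forall>\<alpha>\<in>F. l \<alpha> = 0" ..
  qed
  have direct: "v = 0" if v: "v \<in> Y.span (y ` I)" "v \<in> Y.span (y' ` J)" for v
  proof -
    from v(1) obtain F l where F: "finite F" "F \<subseteq> I" and v_eq: "v = (\<Sum>\<alpha>\<in>F. sy (l \<alpha>) (y \<alpha>))"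
      by (auto simp: Y.span_family)
    \<comment> \<open>A common vector \<open>v\<close> of the two spans has two images under
      \<open>C\<close>: 0 as an element of \<open>Sp y'\<close>, and the combination of the
      \<open>z\<close>-family with the coefficients \<open>l\<close>. Single-valuedness makes them
      equal.\<close>
    have "Y.span (y' ` J) \<subseteq> ker_rel C"
      using y'(2) by (intro Y.span_minimal subspace_ker_rel[OF vs(2,3) lC]) (auto simp: ker_rel_def)
    with v(2) have "(v, 0) \<in> C" unfolding ker_rel_def by blast
    then have 0: "(\<Sum>\<alpha>\<in>F. sz (l \<alpha>) \<alpha>) = 0"
      using C_sum[OF F(2), of l] unfolding v_eq by (intro operator_relD[OF vs(2,3) C])
    \<comment> \<open>For the basis \<open>{0}\<close> the coefficients are not determined, but
      there every \<open>y \<alpha>\<close> is 0; otherwise the coefficients themselves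
      vanish.\<close>
    show ?thesis
    proof (cases "Range A = {0}")
      case True
      then have "y \<alpha> = 0" if "\<alpha> \<in> F" for \<alpha>
        using that F(2) y(3) by blast
      then show ?thesis unfolding v_eq by simp
    next
      case False
      from Z.hamel_basis_sum_eq_0[OF I(2) False F 0] show ?thesis
        unfolding v_eq by simp
    qed
  qed
  have null_y: "null_system I y" if "Range A = {0}"
    using that I(2) y(3) by (auto simp: hamel_basis_def null_system_def)
  have "Y.span (y ` I) \<inter> Y.span (y' ` J) = {0}"
    using direct Y.span_zero by blast
  moreover have "\<forall>\<alpha>\<in>I. y \<alpha> \<in> (A\<inverse> O B) `` {\<alpha>}"
    using y(1) by blast
  ultimately have "admissible sx sy sz A B I (\<lambda>z. z) y J (\<lambda>x. x) y'"
    unfolding admissible_def using I(2) J(2) indep_y null_y y'(1) by simp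
  with y(2) y'(2) show ?thesis
    by (intro exI[of _ I] exI[of _ "\<lambda>z. z"] exI[of _ y] exI[of _ J] exI[of _ "\<lambda>x. x"] exI[of _ y'])
      simp
qed

section \<open>Both directions assembled\<close>

theorem mainTheorem6:
  fixes sx :: "'k :: real_or_complex \<Rightarrow> 'x :: ab_group_add \<Rightarrow> 'x"
    and sy :: "'k \<Rightarrow> 'y :: ab_group_add \<Rightarrow> 'y"
    and sz :: "'k \<Rightarrow> 'z :: ab_group_add \<Rightarrow> 'z"
    and A :: "('x \<times> 'z) set"
    and B :: "('x \<times> 'y) set"
  assumes "vector_space sx" and "vector_space sy" and "vector_space sz"
    and "linear_relation sx sz A"
    and "linear_relation sx sy B"
  shows
    "(\<forall>(I :: 'i set) z y (J :: 'j set) x' y'.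
        admissible sx sy sz A B I z y J x' y' \<longrightarrow>
        (let C = assigned_rel sy sz I z y J y' in
          operator_rel sy sz C \<and>
          A \<subseteq> B O C \<and>
          (\<forall>X. operator_rel sy sz X \<and> C \<subseteq> X \<longrightarrow> A \<subseteq> B O X) \<and>
          Domain C = subspace_sum (module.span sy (y ` I)) (module.span sy (y' ` J)) \<and>
          Range C = Range A \<and>
          ker_rel C = module.span sy (y' ` J))) \<and>
     (\<forall>C. operator_rel sy sz C \<and> A \<subseteq> B O C \<longrightarrow>
        (\<exists>(I :: 'z set) z y (J :: 'x set) x' y'.
          admissible sx sy sz A B I z y J x' y' \<and>
          (let D = subspace_sum (module.span sy (y ` I)) (module.span sy (y' ` J)) in
            D \<subseteq> Domain C \<and>
            C \<inter> (D \<times> UNIV) = assigned_rel sy sz I z y J y')))"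
proof (intro conjI allI impI)
  fix I :: "'i set" and z y and J :: "'j set" and x' y'
  assume "admissible sx sy sz A B I z y J x' y'"
  then interpret admissible_quadruple sx sy sz A B I z y J x' y'
    using assms by (simp add: admissible_quadruple_def admissible_quadruple_axioms_def)
  have "A \<subseteq> B O X" if "C \<subseteq> X" for X
    using subset_comp_C that by blast
  then show "let C = assigned_rel sy sz I z y J y' in
    operator_rel sy sz C \<and> A \<subseteq> B O C \<and>
    (\<forall>X. operator_rel sy sz X \<and> C \<subseteq> X \<longrightarrow> A \<subseteq> B O X) \<and>
    Domain C = subspace_sum (module.span sy (y ` I)) (module.span sy (y' ` J)) \<and>
    Range C = Range A \<and> ker_rel C = module.span sy (y' ` J)"
    by (simp add: Let_def operator_rel_C subset_comp_C ker_rel_C Domain_assigned_rel[OF assms(2)]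
        Range_assigned_rel[OF assms(3)] Z.span_hamel_basis[OF basis_z])
next
  fix C assume "operator_rel sy sz C \<and> A \<subseteq> B O C"
  then have C: "operator_rel sy sz C" and sol: "A \<subseteq> B O C" by auto
  obtain I :: "'z set" and z y and J :: "'x set" and x' y'
    where adm: "admissible sx sy sz A B I z y J x' y'"
      and yz: "\<And>\<alpha>. \<alpha> \<in> I \<Longrightarrow> (y \<alpha>, z \<alpha>) \<in> C" and y': "\<And>\<beta>. \<beta> \<in> J \<Longrightarrow> (y' \<beta>, 0) \<in> C"
    using admissible_from_solution[OF assms C sol] by (elim exE conjE) (simp add: that)
  let ?D = "subspace_sum (module.span sy (y ` I)) (module.span sy (y' ` J))"
  let ?C = "assigned_rel sy sz I z y J y'"
  have sub: "?C \<subseteq> C"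
    using C yz y' assms(2,3) by (intro assigned_rel_subset) (auto simp: operator_rel_def)
  have dom: "Domain ?C = ?D"
    by (rule Domain_assigned_rel[OF assms(2)])
  \<comment> \<open>Any \<open>v\<close> in \<open>?D\<close> already has a value under
    \<open>?C\<close>. As \<open>?C \<subseteq> C\<close> and \<open>C\<close> is single-valued,
    this is the value that \<open>C\<close> assigns to \<open>v\<close>.\<close>
  have "C \<inter> (?D \<times> UNIV) \<subseteq> ?C"
  proof (rule subrelI)
    fix v w assume vw: "(v, w) \<in> C \<inter> (?D \<times> UNIV)"
    then have "v \<in> Domain ?C"
      unfolding dom by simp
    then obtain w' where w': "(v, w') \<in> ?C"
      by (rule DomainE)
    with vw sub have "w = w'"
      by (intro operator_relD[OF assms(2,3) C]) auto
    with w' show "(v, w) \<in> ?C" by simp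
  qed
  moreover have "?C \<subseteq> ?D \<times> UNIV"
    unfolding dom[symmetric] by auto
  ultimately have "C \<inter> (?D \<times> UNIV) = ?C"
    using sub by (simp add: subset_antisym)
  moreover have "?D \<subseteq> Domain C"
    unfolding dom[symmetric] by (rule Domain_mono[OF sub])
  ultimately show "\<exists>(I :: 'z set) z y (J :: 'x set) x' y'.
      admissible sx sy sz A B I z y J x' y' \<and>
      (let D = subspace_sum (module.span sy (y ` I)) (module.span sy (y' ` J)) in
        D \<subseteq> Domain C \<and> C \<inter> (D \<times> UNIV) = assigned_rel sy sz I z y J y')"
    unfolding Let_def using adm
    by (intro exI[of _ I] exI[of _ z] exI[of _ y] exI[of _ J] exI[of _ x'] exI[of _ y'] conjI)
qed

end
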